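(* Let $(X,d)$ be a compact metric space, let $f:X\to X$ be a continuous surjection, and let $\mathbb{F}=(f_n)_{n\in\mathbb{N}}$ be a sequence of feeble open continuous surjections $f_n:X\to X$. Suppose that $\{(\omega^n_{n+k})_{n}:k\in\mathbb{N}\}$ converges collectively to $\{f^k:k\in\mathbb{N}\}$. Then: (1) every proximal cell $\mathrm{Prox}_f(x)$, $x\in X$, is dense in $X$ if and only if every proximal cell $\mathrm{Prox}_{\mathbb{F}}(x)$, $x\in X$, is dense in $X$; (2) the set of pairs proximal for $(X,f)$ is dense in $X\times X$ if and only if the set of pairs proximal for $(X,\mathbb{F})$ is dense in $X\times X$.
   Context: $D(g,h)=\sup_{x\in X}d(g(x),h(x))$ for continuous self maps $g,h$ of $X$. A map $g:X\to X$ is feeble open if $\mathrm{int}(g(U))\neq\emptyset$ for every non-empty open $U\subset X$. For $\mathbb{F}=(f_n)_{n\in\mathbb{N}}$ (with $\mathbb{N}=\{1,2,\dots\}$), put $\omega_n=f_n\circ\cdots\circ f_1$ and $\omega^n_{n+k}=f_{n+k}\circ f_{n+k-1}\circ\cdots\circ f_{n+1}$. The collection of sequences $\{(\omega^n_{n+k})_n:k\in\mathbb{N}\}$ converges collectively to $\{f^k:k\in\mathbb{N}\}$ if for each $\epsilon>0$ there is $n_0\in\mathbb{N}$ such that $D(\omega^n_{n+k},f^k)<\epsilon$ for all $n\ge n_0$ and all $k\in\mathbb{N}$. A pair $(x,y)$ is proximal for the non-autonomous system $(X,\mathbb{F})$ if $\liminf_{n\to\infty}d(\omega_n(x),\omega_n(y))=0$,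 and proximal for $(X,f)$ if $\liminf_{n\to\infty}d(f^n(x),f^n(y))=0$. $\mathrm{Prox}_{\mathbb{F}}(x)$ (resp. $\mathrm{Prox}_f(x)$) is the set of $y\in X$ such that $(x,y)$ is proximal for $(X,\mathbb{F})$ (resp. $(X,f)$). *)

theory Defs
  imports "HOL-Analysis.Analysis"
begin

text \<open>
  The space \<open>X\<close> is the universe of a type of class \<open>metric_space\<close>. A sequence of maps indexed by
  the positive integers is a function on \<open>nat\<close> whose value at \<open>0\<close> is never used.
\<close>

text \<open>On a compact space the supremum is over a nonempty bounded set of reals when \<open>g\<close> and \<open>h\<close> are
  continuous, so it is the true supremum.\<close>

definition sup_dist :: "('a::metric_space \<Rightarrow> 'a) \<Rightarrow> ('a \<Rightarrow> 'a) \<Rightarrow> real" where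
  "sup_dist g h = (SUP x. dist (g x) (h x))"

definition feeble_open :: "('a::topological_space \<Rightarrow> 'a) \<Rightarrow> bool" where
  "feeble_open g \<longleftrightarrow> (\<forall>U. open U \<and> U \<noteq> {} \<longrightarrow> interior (g ` U) \<noteq> {})"

text \<open>\<open>block F n k\<close> is \<open>F (n + k) \<circ> \<dots> \<circ> F (n + 1)\<close>, that is, \<open>\<omega>\<close> with lower index \<open>n + k\<close> and
  upper index \<open>n\<close>.\<close>

primrec block :: "(nat \<Rightarrow> 'a \<Rightarrow> 'a) \<Rightarrow> nat \<Rightarrow> nat \<Rightarrow> 'a \<Rightarrow> 'a" where
  "block F n 0 = id"
| "block F n (Suc k) = F (n + Suc k) \<circ> block F n k"

definition omega :: "(nat \<Rightarrow> 'a \<Rightarrow> 'a) \<Rightarrow> nat \<Rightarrow> 'a \<Rightarrow> 'a" where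
  "omega F n = block F 0 n"

definition converges_collectively ::
    "(nat \<Rightarrow> 'a::metric_space \<Rightarrow> 'a) \<Rightarrow> ('a \<Rightarrow> 'a) \<Rightarrow> bool" where
  "converges_collectively F f \<longleftrightarrow>
     (\<forall>\<epsilon>>0. \<exists>n0\<ge>1. \<forall>n\<ge>n0. \<forall>k\<ge>1. sup_dist (block F n k) (f ^^ k) < \<epsilon>)"

text \<open>The distances are embedded into \<open>ereal\<close> because \<open>liminf\<close> requires a complete lattice.\<close>

definition proximal_seq :: "(nat \<Rightarrow> 'a::metric_space \<Rightarrow> 'a) \<Rightarrow> 'a \<Rightarrow> 'a \<Rightarrow> bool" where
  "proximal_seq F x y \<longleftrightarrow> liminf (\<lambda>n. ereal (dist (omega F n x) (omega F n y))) = 0"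

definition proximal :: "('a::metric_space \<Rightarrow> 'a) \<Rightarrow> 'a \<Rightarrow> 'a \<Rightarrow> bool" where
  "proximal f x y \<longleftrightarrow> liminf (\<lambda>n. ereal (dist ((f ^^ n) x) ((f ^^ n) y))) = 0"

definition Prox_seq :: "(nat \<Rightarrow> 'a::metric_space \<Rightarrow> 'a) \<Rightarrow> 'a \<Rightarrow> 'a set" where
  "Prox_seq F x = {y. proximal_seq F x y}"

definition Prox :: "('a::metric_space \<Rightarrow> 'a) \<Rightarrow> 'a \<Rightarrow> 'a set" where
  "Prox f x = {y. proximal f x y}"

end

theory Submission
  imports Defs
begin

text \<open>
  Proximality means that the orbit distances are infinitely often below each \<open>\<epsilon>\<close>, so proximal
  cells and the proximal relation are \<open>G\<^sub>\<delta>\<close> sets; by Baire's theorem such a set is dense iff every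
  nonempty open set contains, for each \<open>\<epsilon>\<close> and \<open>N\<close>, a point whose orbit distance is below \<open>\<epsilon>\<close> at
  some time \<open>\<ge> N\<close>. This condition moves between the two systems through a single map \<open>\<omega>\<^sub>n\<close> with
  \<open>n\<close> large, since \<open>\<omega>\<^sub>n\<^sub>+\<^sub>k\<close> is uniformly close to \<open>f\<^sup>k \<circ> \<omega>\<^sub>n\<close>: from \<open>f\<close> to \<open>F\<close> by applying it to the
  interior of the image under \<open>\<omega>\<^sub>n\<close> (feeble openness), from \<open>F\<close> to \<open>f\<close> by applying it to the preimage
  under \<open>\<omega>\<^sub>n\<close> (continuity and surjectivity).
\<close>

section \<open>Dense zero sets of a lower limit\<close>

lemma liminf_ereal_eq_0_iff:
  fixes a :: "nat \<Rightarrow> real"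
  assumes nonneg: "\<And>n. 0 \<le> a n"
  shows "liminf (\<lambda>n. ereal (a n)) = 0 \<longleftrightarrow> (\<forall>\<epsilon>>0. \<forall>N. \<exists>n\<ge>N. a n < \<epsilon>)"
proof
  assume L: "liminf (\<lambda>n. ereal (a n)) = 0"
  show "\<forall>\<epsilon>>0. \<forall>N. \<exists>n\<ge>N. a n < \<epsilon>"
  proof (intro allI impI, rule ccontr)
    fix \<epsilon> :: real and N
    assume "\<epsilon> > 0" and "\<not> (\<exists>n\<ge>N. a n < \<epsilon>)"
    then have "eventually (\<lambda>n. ereal \<epsilon> \<le> ereal (a n)) sequentially"
      unfolding eventually_sequentially by (auto simp: not_less)
    then have "ereal \<epsilon> \<le> liminf (\<lambda>n. ereal (a n))"
      by (rule Liminf_bounded)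
    with L \<open>\<epsilon> > 0\<close> show False by simp
  qed
next
  assume R: "\<forall>\<epsilon>>0. \<forall>N. \<exists>n\<ge>N. a n < \<epsilon>"
  show "liminf (\<lambda>n. ereal (a n)) = 0"
  proof (rule antisym)
    show "0 \<le> liminf (\<lambda>n. ereal (a n))"
      by (rule Liminf_bounded) (simp add: nonneg)
    show "liminf (\<lambda>n. ereal (a n)) \<le> 0"
    proof (rule ccontr)
      assume "\<not> liminf (\<lambda>n. ereal (a n)) \<le> 0"
      then have "0 < liminf (\<lambda>n. ereal (a n))" by (simp only: not_le)
      from ereal_dense2[OF this]
      obtain e where e: "0 < ereal e" "ereal e < liminf (\<lambda>n. ereal (a n))" by auto
      from less_LiminfD[OF e(2)] obtain N where "\<And>n. n \<ge> N \<Longrightarrow> e < a n"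
        unfolding eventually_sequentially by auto
      moreover obtain n where "n \<ge> N" "a n < e"
        using R e(1) by auto
      ultimately show False by (meson less_asym)
    qed
  qed
qed

lemma Baire_compact_space:
  fixes \<G> :: "'a::metric_space set set"
  assumes "compact (UNIV :: 'a set)" "countable \<G>"
    and "\<And>T. T \<in> \<G> \<Longrightarrow> open T \<and> closure T = UNIV"
  shows "closure (\<Inter>\<G>) = UNIV"
  using Met_TC.metric_Baire_category[of \<G>] assms
  by (simp add: compact_imp_complete)

lemma closure_eq_UNIV_iff:
  "closure S = UNIV \<longleftrightarrow> (\<forall>U. open U \<and> U \<noteq> {} \<longrightarrow> (\<exists>z\<in>U. z \<in> S))"
proof
  assume "closure S = UNIV"
  then show "\<forall>U. open U \<and> U \<noteq> {} \<longrightarrow> (\<exists>z\<in>U. z \<in> S)"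
    using open_Int_closure_eq_empty[of _ S] by fastforce
next
  assume "\<forall>U. open U \<and> U \<noteq> {} \<longrightarrow> (\<exists>z\<in>U. z \<in> S)"
  then have "- closure S = {}"
    using closure_subset[of S] open_Compl[OF closed_closure] by blast
  then show "closure S = UNIV" by blast
qed

lemma dense_superset: "closure S = UNIV \<Longrightarrow> S \<subseteq> T \<Longrightarrow> closure T = UNIV"
  using closure_mono[of S T] by blast

text \<open>On the right the witness \<open>z\<close> may change with \<epsilon> and
  \<open>N\<close>; Baire category replaces these by a single point of \<open>U\<close> that serves
  all of them. The functions \<open>g n\<close> are general so that the lemma applies both on the
  space, for cells, and on its square, for pairs.\<close>

lemma dense_liminf_zero_iff:
  fixes g :: "nat \<Rightarrow> 'a::metric_space \<Rightarrow> real"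
  assumes "compact (UNIV :: 'a set)"
    and cont: "\<And>n. continuous_on UNIV (g n)"
    and nonneg: "\<And>n z. 0 \<le> g n z"
  shows "closure {z. liminf (\<lambda>n. ereal (g n z)) = 0} = UNIV \<longleftrightarrow>
    (\<forall>U \<epsilon> N. open U \<and> U \<noteq> {} \<and> \<epsilon> > 0 \<longrightarrow> (\<exists>z\<in>U. \<exists>n\<ge>N. g n z < \<epsilon>))" (is "?L \<longleftrightarrow> ?R")
proof
  assume ?L
  then have "\<exists>z\<in>U. \<forall>\<epsilon>>0. \<forall>N. \<exists>n\<ge>N. g n z < \<epsilon>" if "open U" "U \<noteq> {}" for U
    unfolding closure_eq_UNIV_iff liminf_ereal_eq_0_iff[OF nonneg] using that by simp
  then show ?R by blast
next
  assume R: ?R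
  \<comment> \<open>The reciprocals \<open>1 / real (Suc p)\<close> stand in for all \<epsilon>,
    which keeps the family countable.\<close>
  define T where "T = (\<lambda>p N. \<Union>n\<in>{N..}. {z. g n z < 1 / real (Suc p)})"
  have "open {z. g n z < c}" for n c
    using open_Collect_less[OF cont continuous_on_const] .
  then have op: "open (T p N)" for p N
    unfolding T_def by blast
  have dense: "closure (T p N) = UNIV" for p N
    unfolding closure_eq_UNIV_iff T_def
  proof (intro allI impI)
    fix U :: "'a set"
    assume "open U \<and> U \<noteq> {}"
    with R have "\<exists>z\<in>U. \<exists>n\<ge>N. g n z < 1 / real (Suc p)" by simp
    then show "\<exists>z\<in>U. z \<in> (\<Union>n\<in>{N..}. {z. g n z < 1 / real (Suc p)})" by auto
  qed
  have "closure (\<Inter>(range (\<lambda>(p, N). T p N))) = UNIV"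
    by (rule Baire_compact_space) (use assms(1) op dense in auto)
  moreover have "\<Inter>(range (\<lambda>(p, N). T p N)) \<subseteq> {z. liminf (\<lambda>n. ereal (g n z)) = 0}"
    unfolding liminf_ereal_eq_0_iff[OF nonneg]
  proof (intro subsetI CollectI allI impI)
    fix z and \<epsilon> :: real and N
    assume z: "z \<in> \<Inter>(range (\<lambda>(p, N). T p N))" and "0 < \<epsilon>"
    then obtain p where p: "1 / real (Suc p) < \<epsilon>"
      using nat_approx_posE by blast
    from z have "z \<in> T p N" by auto
    with p show "\<exists>n\<ge>N. g n z < \<epsilon>"
      unfolding T_def by (auto intro: less_trans)
  qed
  ultimately show ?L
    by (rule dense_superset)
qed

section \<open>Finite compositions of the maps\<close>

lemma block_closed_induct:
  assumes "\<And>n. n \<ge> 1 \<Longrightarrow> P (F n)" and "P id" and "\<And>g h. P g \<Longrightarrow> P h \<Longrightarrow> P (g \<circ> h)"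
  shows "P (block F n k)"
  \<comment> \<open>The outermost map of a nonempty block has index \<open>n + Suc k\<close>, which
    is at least 1, so the first assumption covers every factor.\<close>
  by (induction k) (simp_all only: block.simps assms le_add2 One_nat_def Suc_le_mono le0 add_Suc_right)

lemma block_add: "block F n (m + k) = block F (n + m) k \<circ> block F n m"
  by (induction k) (auto simp: fun_eq_iff add.assoc)

lemma omega_add: "omega F (n + k) x = block F n k (omega F n x)"
  unfolding omega_def by (simp add: block_add)

lemma feeble_open_comp:
  fixes g h :: "'a::topological_space \<Rightarrow> 'a"
  assumes "feeble_open g" "feeble_open h"
  shows "feeble_open (g \<circ> h)"
  unfolding feeble_open_def
proof (intro allI impI)
  fix U :: "'a set"
  assume U: "open U \<and> U \<noteq> {}"
  with assms have "interior (g ` interior (h ` U)) \<noteq> {}"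
    unfolding feeble_open_def by simp
  moreover have "interior (g ` interior (h ` U)) \<subseteq> interior ((g \<circ> h) ` U)"
    by (metis image_comp image_mono interior_mono interior_subset)
  ultimately show "interior ((g \<circ> h) ` U) \<noteq> {}" by blast
qed

lemma feeble_open_id: "feeble_open id"
  by (simp add: feeble_open_def interior_open)

text \<open>A compact space is bounded, so the set under the real supremum is bounded above.\<close>

lemma dist_le_sup_dist:
  assumes "compact (UNIV :: 'a::metric_space set)"
  shows "dist (g x) (h x) \<le> sup_dist g (h :: 'a \<Rightarrow> 'a)"
  unfolding sup_dist_def
proof (rule cSUP_upper)
  obtain B where "\<And>x y :: 'a. dist x y \<le> B"
    using compact_imp_bounded[OF assms] unfolding bounded_two_points by blast
  then show "bdd_above (range (\<lambda>x. dist (g x) (h x)))"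
    by (intro bdd_aboveI[of _ B]) auto
qed simp

lemma open_Times_witness:
  assumes "open U" "U \<noteq> {}"
  obtains A B where "open A" "A \<noteq> {}" "open B" "B \<noteq> {}" "A \<times> B \<subseteq> U"
proof -
  obtain z where "z \<in> U" using assms(2) by blast
  from open_prod_elim[OF assms(1) this] show thesis
    using that by (metis SigmaE empty_iff)
qed

theorem corollary11:
  fixes f :: "'a::metric_space \<Rightarrow> 'a" and F :: "nat \<Rightarrow> 'a \<Rightarrow> 'a"
  assumes "compact (UNIV :: 'a set)"
    and "continuous_on UNIV f" and "surj f"
    and "\<And>n. n \<ge> 1 \<Longrightarrow> continuous_on UNIV (F n)"
    and "\<And>n. n \<ge> 1 \<Longrightarrow> surj (F n)"
    and "\<And>n. n \<ge> 1 \<Longrightarrow> feeble_open (F n)"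
    and "converges_collectively F f"
  shows "((\<forall>x. closure (Prox f x) = UNIV) \<longleftrightarrow> (\<forall>x. closure (Prox_seq F x) = UNIV)) \<and>
         (closure {(x, y). proximal f x y} = UNIV \<longleftrightarrow> closure {(x, y). proximal_seq F x y} = UNIV)"
proof -

  \<comment> \<open>Comparison of the two systems\<close>
  have cont_\<omega>: "continuous_on UNIV (omega F n)" for n
    unfolding omega_def
    by (rule block_closed_induct)
      (auto simp: assms(4) o_def intro: continuous_on_compose2)
  have surj_\<omega>: "surj (omega F n)" for n
    unfolding omega_def by (rule block_closed_induct) (auto simp only: assms(5) comp_surj surj_id)
  have feeble_\<omega>: "feeble_open (omega F n)" for n
    unfolding omega_def
    by (rule block_closed_induct) (auto simp only: assms(6) feeble_open_comp feeble_open_id)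
  have cont_f: "continuous_on UNIV (f ^^ n)" for n
    by (induction n) (auto simp: o_def intro: continuous_on_compose2[OF assms(2)])

  \<comment> \<open>Collective convergence gives one \<open>n0\<close> for all \<open>k\<close>, so
    times arbitrarily far out stay comparable. Each of the two points contributes an error below
    \<open>\<epsilon> / 2\<close>.\<close>
  have close: "\<exists>n0. \<forall>n\<ge>n0. \<forall>k\<ge>1. \<forall>x y.
      \<bar>dist (omega F (n + k) x) (omega F (n + k) y)
       - dist ((f ^^ k) (omega F n x)) ((f ^^ k) (omega F n y))\<bar> < \<epsilon>"
    if "\<epsilon> > 0" for \<epsilon>
  proof -
    obtain n0 where n0: "\<And>n k. n \<ge> n0 \<Longrightarrow> k \<ge> 1 \<Longrightarrow> sup_dist (block F n k) (f ^^ k) < \<epsilon> / 2"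
      using assms(7) \<open>\<epsilon> > 0\<close> unfolding converges_collectively_def by (meson half_gt_zero)
    have "\<bar>dist (omega F (n + k) x) (omega F (n + k) y)
       - dist ((f ^^ k) (omega F n x)) ((f ^^ k) (omega F n y))\<bar> < \<epsilon>"
      if "n \<ge> n0" "k \<ge> 1" for n k x y
    proof -
      have *: "dist (omega F (n + k) z) ((f ^^ k) (omega F n z)) < \<epsilon> / 2" for z
        unfolding omega_add using dist_le_sup_dist[OF assms(1)] n0[OF that] by (rule le_less_trans)
      have "\<bar>dist a b - dist c d\<bar> \<le> dist a c + dist b d" for a b c d :: 'a
        by metric
      from this[of "omega F (n + k) x" "omega F (n + k) y"
          "(f ^^ k) (omega F n x)" "(f ^^ k) (omega F n y)"]
      show ?thesis using *[of x] *[of y] by linarith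
    qed
    then show ?thesis by blast
  qed

  \<comment> \<open>A singleton \<open>A\<close> describes a cell, an open \<open>A\<close>
    describes pairs; the two transfer steps below are proved for arbitrary sets and so serve both
    claims.\<close>
  define near where
    "near h A B \<epsilon> N \<longleftrightarrow> (\<exists>x\<in>A. \<exists>y\<in>B. \<exists>n\<ge>N. dist (h n x) (h n y) < \<epsilon>)"
    for h :: "nat \<Rightarrow> 'a \<Rightarrow> 'a" and A B \<epsilon> and N :: nat
  have near_mono: "near h A B \<epsilon> N"
    if "near h A' B' \<epsilon>' N'" "A' \<subseteq> A" "B' \<subseteq> B" "\<epsilon>' \<le> \<epsilon>" "N \<le> N'" for h A B A' B' \<epsilon> \<epsilon>' N N'
    using that unfolding near_def by (meson le_trans less_le_trans subsetD)

  \<comment> \<open>The implication sits under the quantifier because the image sets depend on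
    \<open>n\<close>, which must be fixed first. With \<open>n = max n0 N\<close> every time
    \<open>n + k\<close> is at least \<open>N\<close>; the bound 1 is there because the comparison
    holds for \<open>k \<ge> 1\<close>.\<close>
  have to_F: "\<exists>n. near (\<lambda>k. f ^^ k) (omega F n ` A) (omega F n ` B) (\<epsilon> / 2) 1 \<longrightarrow>
      near (omega F) A B \<epsilon> N" if "\<epsilon> > 0" for A B \<epsilon> N
  proof -
    obtain n0 where n0: "\<And>n k x y. n \<ge> n0 \<Longrightarrow> k \<ge> 1 \<Longrightarrow>
      \<bar>dist (omega F (n + k) x) (omega F (n + k) y)
       - dist ((f ^^ k) (omega F n x)) ((f ^^ k) (omega F n y))\<bar> < \<epsilon> / 2"
      using close[OF half_gt_zero[OF \<open>\<epsilon> > 0\<close>]] by blast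
    show ?thesis
    proof (intro exI impI)
      assume "near (\<lambda>k. f ^^ k) (omega F (max n0 N) ` A) (omega F (max n0 N) ` B) (\<epsilon> / 2) 1"
      then obtain x y k where "x \<in> A" "y \<in> B" "k \<ge> 1" and
        k: "dist ((f ^^ k) (omega F (max n0 N) x)) ((f ^^ k) (omega F (max n0 N) y)) < \<epsilon> / 2"
        unfolding near_def by auto
      moreover have "dist (omega F (max n0 N + k) x) (omega F (max n0 N + k) y) < \<epsilon>"
        using n0[OF max.cobounded1 \<open>k \<ge> 1\<close>, of N x y] k by linarith
      ultimately show "near (omega F) A B \<epsilon> N"
        unfolding near_def by (meson max.cobounded2 trans_le_add1)
    qed
  qed

  have to_f: "\<exists>n M. near (omega F) (omega F n -` A) (omega F n -` B) (\<epsilon> / 2) M \<longrightarrow>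
      near (\<lambda>k. f ^^ k) A B \<epsilon> N" if "\<epsilon> > 0" for A B \<epsilon> N
  proof -
    obtain n where n: "\<And>k x y. k \<ge> 1 \<Longrightarrow>
      \<bar>dist (omega F (n + k) x) (omega F (n + k) y)
       - dist ((f ^^ k) (omega F n x)) ((f ^^ k) (omega F n y))\<bar> < \<epsilon> / 2"
      using close[OF half_gt_zero[OF \<open>\<epsilon> > 0\<close>]] by blast
    show ?thesis
    proof (intro exI impI)
      \<comment> \<open>Starting at \<open>n + Suc N\<close> leaves \<open>k = m - n\<close> at
        least \<open>Suc N\<close>, which gives both \<open>k \<ge> 1\<close> for the comparison and
        \<open>k \<ge> N\<close> for the conclusion.\<close>
      assume "near (omega F) (omega F n -` A) (omega F n -` B) (\<epsilon> / 2) (n + Suc N)"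
      then obtain x y m where xy: "omega F n x \<in> A" "omega F n y \<in> B" and "m \<ge> n + Suc N"
        and m: "dist (omega F m x) (omega F m y) < \<epsilon> / 2"
        unfolding near_def by auto
      from \<open>m \<ge> n + Suc N\<close> obtain k where k: "m = n + k" "k \<ge> Suc N"
        using that[of "m - n"] by simp
      then have "k \<ge> 1" by simp
      from n[OF this, of x y] m have "dist ((f ^^ k) (omega F n x)) ((f ^^ k) (omega F n y)) < \<epsilon>"
        unfolding k(1) by linarith
      with xy k(2) show "near (\<lambda>k. f ^^ k) A B \<epsilon> N"
        unfolding near_def by (meson Suc_leD)
    qed
  qed

  have cell: "closure {y. liminf (\<lambda>n. ereal (dist (h n x) (h n y))) = 0} = UNIV \<longleftrightarrow>
      (\<forall>U \<epsilon> N. open U \<and> U \<noteq> {} \<and> \<epsilon> > 0 \<longrightarrow> near h {x} U \<epsilon> N)"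
    if "\<And>n. continuous_on UNIV (h n)" for h x
    unfolding near_def using assms(1) that
    by (subst dense_liminf_zero_iff) (auto intro: continuous_on_dist continuous_on_const)

  have pairs: "closure {(x, y). liminf (\<lambda>n. ereal (dist (h n x) (h n y))) = 0} = UNIV \<longleftrightarrow>
      (\<forall>A B \<epsilon> N. open A \<and> A \<noteq> {} \<and> open B \<and> B \<noteq> {} \<and> \<epsilon> > 0 \<longrightarrow> near h A B \<epsilon> N)"
    (is "closure ?S = UNIV \<longleftrightarrow> ?R")
    if h: "\<And>n. continuous_on UNIV (h n)" for h
  proof -
    have S: "?S = {p. liminf (\<lambda>n. ereal (dist (h n (fst p)) (h n (snd p)))) = 0}"
      by auto
    have "compact (UNIV :: ('a \<times> 'a) set)"
      using compact_Times[OF assms(1) assms(1)] by simp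
    moreover have "continuous_on UNIV (\<lambda>p. dist (h n (fst p)) (h n (snd p)))" for n
      by (intro continuous_on_dist continuous_on_compose2[OF h] continuous_intros) auto
    ultimately have "closure ?S = UNIV \<longleftrightarrow> (\<forall>U \<epsilon> N. open U \<and> U \<noteq> {} \<and> \<epsilon> > 0 \<longrightarrow>
        (\<exists>p\<in>U. \<exists>n\<ge>N. dist (h n (fst p)) (h n (snd p)) < \<epsilon>))" (is "_ \<longleftrightarrow> ?Q")
      unfolding S by (rule dense_liminf_zero_iff) simp
    \<comment> \<open>Products of nonempty open sets are instances of \<open>U\<close>, and every
      nonempty open \<open>U\<close> contains such a product.\<close>
    also have "\<dots> \<longleftrightarrow> ?R"
    proof
      assume Q: ?Q
      show ?R
      proof (intro allI impI)
        fix A B :: "'a set" and \<epsilon> :: real and N :: nat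
        assume "open A \<and> A \<noteq> {} \<and> open B \<and> B \<noteq> {} \<and> \<epsilon> > 0"
        with Q[rule_format, of "A \<times> B" \<epsilon> N] show "near h A B \<epsilon> N"
          unfolding near_def by (auto simp: open_Times)
      qed
    next
      assume R: ?R
      show ?Q
      proof (intro allI impI)
        fix U :: "('a \<times> 'a) set" and \<epsilon> :: real and N :: nat
        assume U: "open U \<and> U \<noteq> {} \<and> \<epsilon> > 0"
        then obtain A B where "open A" "A \<noteq> {}" "open B" "B \<noteq> {}" and AB: "A \<times> B \<subseteq> U"
          using open_Times_witness by blast
        with R U have "near h A B \<epsilon> N" by simp
        with AB show "\<exists>p\<in>U. \<exists>n\<ge>N. dist (h n (fst p)) (h n (snd p)) < \<epsilon>"
          unfolding near_def by (metis SigmaI fst_conv snd_conv subsetD)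
      qed
    qed
    finally show ?thesis .
  qed

  have image: "interior (omega F n ` U) \<noteq> {}" if "open U" "U \<noteq> {}" for n and U :: "'a set"
    using feeble_\<omega> that unfolding feeble_open_def by blast
  have preimage: "open (omega F n -` U) \<and> omega F n -` U \<noteq> {}" if "open U" "U \<noteq> {}" for n and U :: "'a set"
    using that open_vimage[OF _ cont_\<omega>] surj_image_vimage_eq[OF surj_\<omega>] by (metis image_empty)

  \<comment> \<open>Density of the proximal cells\<close>
  have "(\<forall>x. closure (Prox f x) = UNIV) \<longleftrightarrow> (\<forall>x. closure (Prox_seq F x) = UNIV)"
    unfolding Prox_def Prox_seq_def proximal_def proximal_seq_def
      cell[where h = "\<lambda>k. f ^^ k", OF cont_f] cell[where h = "omega F", OF cont_\<omega>]
  proof (intro iffI allI impI)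
    fix x and U :: "'a set" and N and \<epsilon> :: real
    assume f: "\<forall>x U \<epsilon> N. open U \<and> U \<noteq> {} \<and> \<epsilon> > 0 \<longrightarrow> near (\<lambda>k. f ^^ k) {x} U \<epsilon> N"
      and U: "open U \<and> U \<noteq> {} \<and> \<epsilon> > 0"
    from U obtain n where n: "near (\<lambda>k. f ^^ k) (omega F n ` {x}) (omega F n ` U) (\<epsilon> / 2) 1 \<longrightarrow>
      near (omega F) {x} U \<epsilon> N" using to_F by blast
    \<comment> \<open>The cell of \<open>x\<close> for \<open>F\<close> is reached through the cell
      of another point, \<open>omega F n x\<close>, for \<open>f\<close>; hence the assumption on
      all cells.\<close>
    have "near (\<lambda>k. f ^^ k) {omega F n x} (interior (omega F n ` U)) (\<epsilon> / 2) 1"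
      using f image U by simp
    from near_mono[OF this _ interior_subset] n show "near (omega F) {x} U \<epsilon> N" by simp
  next
    fix x and U :: "'a set" and N and \<epsilon> :: real
    assume F: "\<forall>x U \<epsilon> N. open U \<and> U \<noteq> {} \<and> \<epsilon> > 0 \<longrightarrow> near (omega F) {x} U \<epsilon> N"
      and U: "open U \<and> U \<noteq> {} \<and> \<epsilon> > 0"
    from U obtain n M where n: "near (omega F) (omega F n -` {x}) (omega F n -` U) (\<epsilon> / 2) M \<longrightarrow>
      near (\<lambda>k. f ^^ k) {x} U \<epsilon> N" using to_f by blast
    \<comment> \<open>The fibre over \<open>x\<close> need not be a single point; by surjectivity it
      has a point, and the cell of any such point for \<open>F\<close> suffices.\<close>
    obtain x' where x': "omega F n x' = x"
      using surj_\<omega> by (metis surjD)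
    have "near (omega F) {x'} (omega F n -` U) (\<epsilon> / 2) M"
      using F preimage U by simp
    from near_mono[OF this _ order_refl] n x' show "near (\<lambda>k. f ^^ k) {x} U \<epsilon> N" by simp
  qed

  \<comment> \<open>Density of the proximal pairs\<close>
  moreover have "closure {(x, y). proximal f x y} = UNIV \<longleftrightarrow>
      closure {(x, y). proximal_seq F x y} = UNIV"
    unfolding proximal_def proximal_seq_def
      pairs[where h = "\<lambda>k. f ^^ k", OF cont_f] pairs[where h = "omega F", OF cont_\<omega>]
  proof (intro iffI allI impI)
    fix A B :: "'a set" and N and \<epsilon> :: real
    assume f: "\<forall>A B \<epsilon> N. open A \<and> A \<noteq> {} \<and> open B \<and> B \<noteq> {} \<and> \<epsilon> > 0 \<longrightarrow> near (\<lambda>k. f ^^ k) A B \<epsilon> N"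
      and AB: "open A \<and> A \<noteq> {} \<and> open B \<and> B \<noteq> {} \<and> \<epsilon> > 0"
    from AB obtain n where n: "near (\<lambda>k. f ^^ k) (omega F n ` A) (omega F n ` B) (\<epsilon> / 2) 1 \<longrightarrow>
      near (omega F) A B \<epsilon> N" using to_F by blast
    have "near (\<lambda>k. f ^^ k) (interior (omega F n ` A)) (interior (omega F n ` B)) (\<epsilon> / 2) 1"
      using f image AB by simp
    from near_mono[OF this interior_subset interior_subset] n show "near (omega F) A B \<epsilon> N" by simp
  next
    fix A B :: "'a set" and N and \<epsilon> :: real
    assume F: "\<forall>A B \<epsilon> N. open A \<and> A \<noteq> {} \<and> open B \<and> B \<noteq> {} \<and> \<epsilon> > 0 \<longrightarrow> near (omega F) A B \<epsilon> N"
      and AB: "open A \<and> A \<noteq> {} \<and> open B \<and> B \<noteq> {} \<and> \<epsilon> > 0"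
    from AB obtain n M where n: "near (omega F) (omega F n -` A) (omega F n -` B) (\<epsilon> / 2) M \<longrightarrow>
      near (\<lambda>k. f ^^ k) A B \<epsilon> N" using to_f by blast
    have "near (omega F) (omega F n -` A) (omega F n -` B) (\<epsilon> / 2) M"
      using F preimage AB by simp
    with n show "near (\<lambda>k. f ^^ k) A B \<epsilon> N" by simp
  qed
  ultimately show ?thesis by blast
qed

end
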